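(* Let $p(x)=75x^{10}+900x^9+4840x^8+15370x^7+31865x^6+45050x^5+44101x^4+29700x^3+13290x^2+3600x+450$. Then the function $$g(x)=[\psi'(x)]^2+\psi''(x)-\frac{p(x)}{900\,x^4(x+1)^{10}}$$ is completely monotonic on $(0,\infty)$.
   Context: The Euler gamma function is $\Gamma(x)=\int_0^\infty t^{x-1}e^{-t}\,dt$ for $x>0$. The psi (digamma) function is $\psi(x)=\frac{\Gamma'(x)}{\Gamma(x)}$ for $x>0$, and $\psi'$, $\psi''$ denote its first and second derivatives (the trigamma and tetragamma functions). A function $f$ is said to be completely monotonic on an interval $I$ if $f$ has derivatives of all orders on $I$ and $(-1)^n f^{(n)}(x)\ge 0$ for all $x\in I$ and all integers $n\ge 0$. *)

theory Defs
  imports "HOL-Analysis.Analysis"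
begin

text \<open>
  \<^term>\<open>D n\<close> is the \<^term>\<open>n\<close>-th derivative of \<^term>\<open>f\<close>. Derivatives are taken within
  \<^term>\<open>I\<close>, hence one-sided at an endpoint that belongs to \<^term>\<open>I\<close>; on an interval with more
  than one point \<^term>\<open>D\<close> is thus uniquely determined on \<^term>\<open>I\<close>.
\<close>

definition completely_monotonic_on :: "real set \<Rightarrow> (real \<Rightarrow> real) \<Rightarrow> bool" where
  "completely_monotonic_on I f \<longleftrightarrow>
     (\<exists>D :: nat \<Rightarrow> real \<Rightarrow> real.
        (\<forall>x\<in>I. D 0 x = f x) \<and>
        (\<forall>n. \<forall>x\<in>I. (D n has_real_derivative D (Suc n) x) (at x within I)) \<and>
        (\<forall>n. \<forall>x\<in>I. (-1) ^ n * D n x \<ge> 0))"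

lemma completely_monotonic_on_open_iff:
  assumes I: "open I"
  shows "completely_monotonic_on I f \<longleftrightarrow>
           (\<forall>n. \<forall>x\<in>I. (deriv ^^ n) f field_differentiable at x \<and> (-1) ^ n * (deriv ^^ n) f x \<ge> 0)"
proof
  assume "completely_monotonic_on I f"
  then obtain D where D: "\<forall>x\<in>I. D 0 x = f x"
      "\<forall>n. \<forall>x\<in>I. (D n has_real_derivative D (Suc n) x) (at x within I)"
      "\<forall>n. \<forall>x\<in>I. (-1) ^ n * D n x \<ge> 0"
    unfolding completely_monotonic_on_def by blast
  have D0: "D 0 x = f x" and sgn: "(-1) ^ n * D n x \<ge> 0" if "x \<in> I" for n x
    using D that by blast+
  have DS: "(D n has_real_derivative D (Suc n) x) (at x)" if "x \<in> I" for n x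
    using D(2) that by (metis at_within_open[OF that I])
  have der: "((deriv ^^ n) f has_real_derivative D (Suc n) x) (at x)"
    if "\<And>y. y \<in> I \<Longrightarrow> (deriv ^^ n) f y = D n y" and x: "x \<in> I" for n x
    by (rule has_field_derivative_transform_within_open[OF DS[OF x] I x]) (simp add: that(1))
  have eq: "\<forall>x\<in>I. (deriv ^^ n) f x = D n x" for n
  proof (induction n)
    case 0
    show ?case by (simp add: D0)
  next
    case (Suc n)
    then show ?case by (auto intro!: DERIV_imp_deriv der)
  qed
  have "(deriv ^^ n) f field_differentiable at x" if "x \<in> I" for n x
    using der[of n x] eq[of n] that unfolding field_differentiable_def by blast
  then show "\<forall>n. \<forall>x\<in>I. (deriv ^^ n) f field_differentiable at x \<and> (-1) ^ n * (deriv ^^ n) f x \<ge> 0"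
    using eq sgn by simp
next
  assume R: "\<forall>n. \<forall>x\<in>I. (deriv ^^ n) f field_differentiable at x \<and> (-1) ^ n * (deriv ^^ n) f x \<ge> 0"
  have "((deriv ^^ n) f has_real_derivative (deriv ^^ Suc n) f x) (at x within I)" if "x \<in> I" for n x
  proof (rule has_field_derivative_at_within)
    show "((deriv ^^ n) f has_real_derivative (deriv ^^ Suc n) f x) (at x)"
      using R that DERIV_deriv_iff_field_differentiable[of "(deriv ^^ n) f" x] by simp
  qed
  then show "completely_monotonic_on I f"
    unfolding completely_monotonic_on_def using R
    by (intro exI[of _ "\<lambda>n. (deriv ^^ n) f"]) auto
qed

text \<open>
  The library introduces \<^term>\<open>Digamma\<close> and the \<^const>\<open>Polygamma\<close> functions by series. On the
  positive reals these are the logarithmic derivative of \<^const>\<open>Gamma\<close> and its derivatives.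
\<close>

lemma Digamma_eq_deriv_Gamma:
  fixes x :: real
  assumes "x > 0"
  shows "Digamma x = deriv Gamma x / Gamma x"
proof -
  have "x \<notin> \<int>\<^sub>\<le>\<^sub>0"
    using assms by (auto elim!: nonpos_Ints_cases)
  then have "deriv Gamma x = Gamma x * Digamma x"
    by (intro DERIV_imp_deriv has_field_derivative_Gamma)
  then show ?thesis
    using Gamma_real_pos[OF assms] by simp
qed

lemma deriv_Polygamma_real:
  fixes x :: real
  assumes "x > 0"
  shows "deriv (Polygamma n) x = Polygamma (Suc n) x"
  using assms
  by (intro DERIV_imp_deriv has_field_derivative_Polygamma) (auto elim!: nonpos_Ints_cases)

lemma deriv_deriv_Digamma_real:
  fixes x :: real
  assumes "x > 0"
  shows "deriv (deriv Digamma) x = Polygamma 2 x"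
proof -
  have "(deriv Digamma has_real_derivative Polygamma (Suc 1) x) (at x)"
  proof (rule has_field_derivative_transform_within_open[where S = "{0<..}"])
    show "(Polygamma 1 has_real_derivative Polygamma (Suc 1) x) (at x)"
      using assms by (intro has_field_derivative_Polygamma) (auto elim!: nonpos_Ints_cases)
  qed (use assms in \<open>auto simp: deriv_Polygamma_real\<close>)
  then show ?thesis
    by (simp add: DERIV_imp_deriv numeral_2_eq_2)
qed

end

theory Submission
  imports Defs
begin

text \<open>
  Write \<open>B(y) = 1/y + 1/(2y\<^sup>2) + 1/(6y\<^sup>3) - 1/(30y\<^sup>5)\<close> for a truncation of the asymptotic
  expansion of the trigamma function \<open>\<psi>'\<close>. As \<open>\<psi>'(x) = 1/x\<^sup>2 + \<psi>'(x+1)\<close>, the function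
  \<open>R(x) = 1/x\<^sup>2 + B(x+1)\<close> approximates \<open>\<psi>'\<close>, and \<open>S(x) = -1/x\<^sup>2 - 1/x\<^sup>3 - 1/(2x\<^sup>4)\<close>
  approximates \<open>\<psi>''\<close>. The rational function to be subtracted is exactly \<open>R\<^sup>2 + S\<close>: the
  denominator \<open>(x+1)\<^sup>1\<^sup>0\<close> and the factor \<open>900 = 30\<^sup>2\<close> come from squaring the last term of \<open>B\<close>. Hence
  \<open>g = (\<psi>' - R)(\<psi>' + R) + (\<psi>'' - S)\<close>.
  Completely monotonic functions are closed under sums and products, so it is enough that \<open>R\<close>,
  \<open>\<psi>' - R\<close> and \<open>\<psi>'' - S\<close> are completely monotonic. For \<open>R\<close> this is a partial fraction
  decomposition with nonnegative coefficients.

  For the other two a telescoping argument is used. If \<open>h\<close> and all its derivatives vanish at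
  infinity and \<open>h(x) - h(x+1)\<close> is completely monotonic, then so is \<open>h\<close>, because
  \<open>(-1)\<^sup>n h\<^sup>(\<^sup>n\<^sup>)(x)\<close> decreases along \<open>x, x+1, x+2, \<dots>\<close> to 0
  (lemma \<open>completely_monotonic_diff_of_shift\<close>). The recurrences of the polygamma functions turn
  these differences into rational functions, which are sums of terms
  \<open>1/(x\<^sup>i(x+1)\<^sup>j)\<close> with positive coefficients (lemmas \<open>completely_monotonic_trigamma_bound\<close> and
  \<open>completely_monotonic_tetragamma_bound\<close>).
\<close>

section \<open>Closure properties of complete monotonicity\<close>

text \<open>
  Complete monotonicity is the largest property of functions that implies nonnegativity and is
  preserved by \<open>f \<mapsto> -f'\<close>. Coinduction makes the closure properties below a matter of the first
  derivative only; no formula for the \<open>n\<close>-th derivative is needed.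
\<close>

lemma completely_monotonic_on_coinduct:
  assumes "P f"
    and step: "\<And>f. P f \<Longrightarrow> \<exists>f'. P f' \<and> (\<forall>x\<in>I. 0 \<le> f x \<and> (f has_real_derivative - f' x) (at x within I))"
  shows "completely_monotonic_on I f"
proof -
  obtain d where d: "\<And>f. P f \<Longrightarrow> P (d f) \<and>
      (\<forall>x\<in>I. 0 \<le> f x \<and> (f has_real_derivative - d f x) (at x within I))"
    using step by metis
  define F where "F n = (d ^^ n) f" for n
  have P: "P (F n)" for n
    by (induction n) (use assms(1) d in \<open>auto simp: F_def\<close>)
  have F_Suc: "F (Suc n) = d (F n)" for n
    by (simp add: F_def)
  show ?thesis
    unfolding completely_monotonic_on_def
  proof (intro exI[of _ "\<lambda>n x. (-1) ^ n * F n x"] conjI allI ballI)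
    fix n x assume "x \<in> I"
    with d[OF P[of n]] have nonneg: "0 \<le> F n x"
      and "(F n has_real_derivative - F (Suc n) x) (at x within I)"
      by (auto simp: F_Suc)
    then show "((\<lambda>x. (-1) ^ n * F n x) has_real_derivative (-1) ^ Suc n * F (Suc n) x) (at x within I)"
      by (auto intro!: derivative_eq_intros)
    show "0 \<le> (-1) ^ n * ((-1) ^ n * F n x)"
      using nonneg by (simp flip: mult.assoc power_mult_distrib)
  qed (simp add: F_def)
qed

text \<open>
  The matching destruction rule. The sign is absorbed, so that the function obtained is
  completely monotonic itself.
\<close>

lemma completely_monotonic_on_derivE:
  assumes "completely_monotonic_on I f"
  obtains f' where "completely_monotonic_on I f'"
    and "\<And>x. x \<in> I \<Longrightarrow> (f has_real_derivative - f' x) (at x within I)"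
proof -
  obtain D where D: "\<forall>x\<in>I. D 0 x = f x"
      "\<forall>n. \<forall>x\<in>I. (D n has_real_derivative D (Suc n) x) (at x within I)"
      "\<forall>n. \<forall>x\<in>I. (-1) ^ n * D n x \<ge> 0"
    using assms unfolding completely_monotonic_on_def by blast
  show thesis
  proof
    show "completely_monotonic_on I (\<lambda>x. - D 1 x)"
      unfolding completely_monotonic_on_def
    proof (intro exI[of _ "\<lambda>n x. - D (Suc n) x"] conjI allI ballI)
      fix n x assume x: "x \<in> I"
      show "((\<lambda>x. - D (Suc n) x) has_real_derivative - D (Suc (Suc n)) x) (at x within I)"
        using D(2) x by (blast intro: DERIV_minus)
      show "0 \<le> (-1) ^ n * - D (Suc n) x"
        using D(3)[rule_format, OF x, of "Suc n"] by simp
    qed simp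
    fix x assume x: "x \<in> I"
    then have "(D 0 has_real_derivative - (- D 1 x)) (at x within I)"
      using D(2)[rule_format, OF x, of 0] by simp
    then show "(f has_real_derivative - (- D 1 x)) (at x within I)"
      by (rule has_field_derivative_transform_within[OF _ zero_less_one x]) (use D(1) in simp)
  qed
qed

lemma completely_monotonic_on_nonneg:
  "completely_monotonic_on I f \<Longrightarrow> x \<in> I \<Longrightarrow> 0 \<le> f x"
  unfolding completely_monotonic_on_def by (metis mult_1 power_0)

lemma completely_monotonic_on_cong:
  assumes "completely_monotonic_on I f" "\<And>x. x \<in> I \<Longrightarrow> f x = g x"
  shows "completely_monotonic_on I g"
  using assms unfolding completely_monotonic_on_def by metis

lemma completely_monotonic_on_const:
  "0 \<le> c \<Longrightarrow> completely_monotonic_on I (\<lambda>x. c)"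
  by (rule completely_monotonic_on_coinduct[where P = "\<lambda>f. \<exists>c\<ge>0. f = (\<lambda>x. c)"])
     (auto intro!: exI[of _ "\<lambda>x. 0"])

lemma completely_monotonic_on_add:
  assumes "completely_monotonic_on I f" "completely_monotonic_on I g"
  shows "completely_monotonic_on I (\<lambda>x. f x + g x)"
proof (rule completely_monotonic_on_coinduct)
  let ?P = "\<lambda>h. \<exists>f g. completely_monotonic_on I f \<and> completely_monotonic_on I g \<and> h = (\<lambda>x. f x + g x)"
  show "?P (\<lambda>x. f x + g x)"
    using assms by blast
  fix h assume "?P h"
  then obtain f g where f: "completely_monotonic_on I f" and g: "completely_monotonic_on I g"
    and h: "h = (\<lambda>x. f x + g x)"
    by blast
  obtain f' where f': "completely_monotonic_on I f'"
    "\<And>x. x \<in> I \<Longrightarrow> (f has_real_derivative - f' x) (at x within I)"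
    using completely_monotonic_on_derivE[OF f] by blast
  obtain g' where g': "completely_monotonic_on I g'"
    "\<And>x. x \<in> I \<Longrightarrow> (g has_real_derivative - g' x) (at x within I)"
    using completely_monotonic_on_derivE[OF g] by blast
  have "(h has_real_derivative - (f' x + g' x)) (at x within I)" if "x \<in> I" for x
    unfolding h using f'(2)[OF that] g'(2)[OF that] by (auto intro!: derivative_eq_intros)
  moreover have "0 \<le> h x" if "x \<in> I" for x
    unfolding h using that f g by (intro add_nonneg_nonneg completely_monotonic_on_nonneg)
  moreover have "?P (\<lambda>x. f' x + g' x)"
    using f'(1) g'(1) by blast
  ultimately show "\<exists>h'. ?P h' \<and> (\<forall>x\<in>I. 0 \<le> h x \<and> (h has_real_derivative - h' x) (at x within I))"
    by blast
qed

text \<open>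
  Products alone are not preserved by \<open>f \<mapsto> -f'\<close>, as the product rule yields a sum of two
  products. Finite sums of products are, and they serve as the coinduction invariant in place of
  the general Leibniz rule.
\<close>

inductive sum_of_cm_products :: "real set \<Rightarrow> (real \<Rightarrow> real) \<Rightarrow> bool" for I where
  product: "completely_monotonic_on I f \<Longrightarrow> completely_monotonic_on I g
    \<Longrightarrow> sum_of_cm_products I (\<lambda>x. f x * g x)"
| sum: "sum_of_cm_products I f \<Longrightarrow> sum_of_cm_products I g
    \<Longrightarrow> sum_of_cm_products I (\<lambda>x. f x + g x)"

lemma completely_monotonic_on_mult:
  assumes "completely_monotonic_on I f" "completely_monotonic_on I g"
  shows "completely_monotonic_on I (\<lambda>x. f x * g x)"
proof (rule completely_monotonic_on_coinduct)
  show "sum_of_cm_products I (\<lambda>x. f x * g x)"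
    using assms by (rule sum_of_cm_products.product)
  show "\<exists>h'. sum_of_cm_products I h' \<and>
      (\<forall>x\<in>I. 0 \<le> h x \<and> (h has_real_derivative - h' x) (at x within I))"
    if "sum_of_cm_products I h" for h
    using that
  proof induction
    case (product f g)
    obtain f' where f': "completely_monotonic_on I f'"
      "\<And>x. x \<in> I \<Longrightarrow> (f has_real_derivative - f' x) (at x within I)"
      using completely_monotonic_on_derivE[OF product(1)] by blast
    obtain g' where g': "completely_monotonic_on I g'"
      "\<And>x. x \<in> I \<Longrightarrow> (g has_real_derivative - g' x) (at x within I)"
      using completely_monotonic_on_derivE[OF product(2)] by blast
    have "((\<lambda>x. f x * g x) has_real_derivative - (f' x * g x + f x * g' x)) (at x within I)"
      if "x \<in> I" for x
      using f'(2)[OF that] g'(2)[OF that] by (auto intro!: derivative_eq_intros)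
    moreover have "sum_of_cm_products I (\<lambda>x. f' x * g x + f x * g' x)"
      using product f'(1) g'(1) by (intro sum_of_cm_products.intros)
    moreover have "0 \<le> f x * g x" if "x \<in> I" for x
      using that product by (intro mult_nonneg_nonneg completely_monotonic_on_nonneg)
    ultimately show ?case
      by (intro exI[of _ "\<lambda>x. f' x * g x + f x * g' x"] conjI ballI)
  next
    case (sum f g)
    then obtain f' g' where "sum_of_cm_products I f'" "sum_of_cm_products I g'"
      and "\<forall>x\<in>I. 0 \<le> f x \<and> (f has_real_derivative - f' x) (at x within I)"
      and "\<forall>x\<in>I. 0 \<le> g x \<and> (g has_real_derivative - g' x) (at x within I)"
      by blast
    then show ?case
      by (intro exI[of _ "\<lambda>x. f' x + g' x"])
         (auto intro!: sum_of_cm_products.sum derivative_eq_intros)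
  qed
qed

lemma completely_monotonic_on_shift:
  assumes "completely_monotonic_on {0<..} f" "0 \<le> c"
  shows "completely_monotonic_on {0<..} (\<lambda>x. f (x + c))"
proof (rule completely_monotonic_on_coinduct)
  let ?P = "\<lambda>h. \<exists>f. completely_monotonic_on {0<..} f \<and> h = (\<lambda>x. f (x + c))"
  show "?P (\<lambda>x. f (x + c))"
    using assms by blast
  fix h assume "?P h"
  then obtain f where f: "completely_monotonic_on {0<..} f" and h: "h = (\<lambda>x. f (x + c))"
    by blast
  obtain f' where f': "completely_monotonic_on {0<..} f'"
    "\<And>x. x \<in> {0<..} \<Longrightarrow> (f has_real_derivative - f' x) (at x within {0<..})"
    using completely_monotonic_on_derivE[OF f] by blast
  have "(h has_real_derivative - f' (x + c)) (at x)" if "0 < x" for x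
    unfolding h using f'(2)[of "x + c"] that assms(2)
    by (simp add: at_within_open[of _ "{0<..}"] DERIV_shift)
  then have "(h has_real_derivative - f' (x + c)) (at x within {0<..})" if "0 < x" for x
    using that by (blast intro: has_field_derivative_at_within)
  moreover have "0 \<le> h x" if "0 < x" for x
    unfolding h using completely_monotonic_on_nonneg[OF f, of "x + c"] that assms(2) by simp
  ultimately show "\<exists>h'. ?P h' \<and>
      (\<forall>x\<in>{0<..}. 0 \<le> h x \<and> (h has_real_derivative - h' x) (at x within {0<..}))"
    using f'(1) by (intro exI[of _ "\<lambda>x. f' (x + c)"]) auto
qed

lemma completely_monotonic_on_inverse_power:
  "completely_monotonic_on {0<..} (\<lambda>x. 1 / x ^ k)"
proof (rule completely_monotonic_on_coinduct)
  \<comment> \<open>The factor \<open>c\<close> collects the exponents that successive derivatives bring down.\<close>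
  let ?P = "\<lambda>f. \<exists>c\<ge>0. \<exists>k. f = (\<lambda>x::real. c / x ^ k)"
  show "?P (\<lambda>x. 1 / x ^ k)"
    using zero_le_one by blast
  fix f assume "?P f"
  then obtain c k where c: "c \<ge> 0" and f: "f = (\<lambda>x::real. c / x ^ k)"
    by blast
  have "(f has_real_derivative - (c * real k / x ^ Suc k)) (at x within {0<..})" if "0 < x" for x
  proof -
    have "(f has_real_derivative c * - (inverse (x ^ k) * (real k * x ^ (k - Suc 0)) * inverse (x ^ k)))
        (at x within {0<..})"
      unfolding f divide_inverse using that by (auto intro!: derivative_eq_intros)
    also have "c * - (inverse (x ^ k) * (real k * x ^ (k - Suc 0)) * inverse (x ^ k))
        = - (c * real k / x ^ Suc k)"
      using that by (cases k) (auto simp: divide_simps)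
    finally show ?thesis .
  qed
  moreover have "0 \<le> f x" if "0 < x" for x
    unfolding f using c that by simp
  moreover have "?P (\<lambda>x. c * real k / x ^ Suc k)"
    using c by (intro exI[of _ "c * real k"] exI[of _ "Suc k"] conjI refl mult_nonneg_nonneg) auto
  ultimately show "\<exists>f'. ?P f' \<and>
      (\<forall>x\<in>{0<..}. 0 \<le> f x \<and> (f has_real_derivative - f' x) (at x within {0<..}))"
    by blast
qed

lemma completely_monotonic_on_inverse_power_Suc:
  "completely_monotonic_on {0<..} (\<lambda>x. 1 / (x + 1) ^ k)"
  using completely_monotonic_on_shift[OF completely_monotonic_on_inverse_power, of 1] by simp

lemmas completely_monotonic_on_intros =
  completely_monotonic_on_const completely_monotonic_on_add completely_monotonic_on_mult
  completely_monotonic_on_inverse_power completely_monotonic_on_inverse_power_Suc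

section \<open>Comparison through differences\<close>

lemma completely_monotonic_on_antimono:
  assumes "completely_monotonic_on {0<..} f" "0 < x" "x \<le> y"
  shows "f y \<le> f x"
proof -
  obtain f' where f': "completely_monotonic_on {0<..} f'"
    "\<And>x. x \<in> {0<..} \<Longrightarrow> (f has_real_derivative - f' x) (at x within {0<..})"
    using completely_monotonic_on_derivE[OF assms(1)] by blast
  show ?thesis
  proof (rule DERIV_nonpos_imp_nonincreasing[OF assms(3)])
    fix z assume "x \<le> z"
    then have "z \<in> {0<..}"
      using assms(2) by simp
    then show "\<exists>d. (f has_real_derivative d) (at z) \<and> d \<le> 0"
      using f'(2)[of z] completely_monotonic_on_nonneg[OF f'(1), of z]
      by (intro exI[of _ "- f' z"]) (simp add: at_within_open[of _ "{0<..}"])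
  qed
qed

text \<open>
  By the mean value theorem \<open>f (x - 1) - f x\<close> is a value of \<open>f'\<close> to the left of \<open>x\<close>, which bounds
  \<open>f' x\<close> by monotonicity. So vanishing at infinity passes on to all derivatives.
\<close>

lemma completely_monotonic_deriv_tendsto_0:
  assumes f: "completely_monotonic_on {0<..} f" and f': "completely_monotonic_on {0<..} f'"
    and deriv: "\<And>x. 0 < x \<Longrightarrow> (f has_real_derivative - f' x) (at x)"
    and lim: "(f \<longlongrightarrow> 0) at_top"
  shows "(f' \<longlongrightarrow> 0) at_top"
proof (rule tendsto_sandwich[OF _ _ tendsto_const])
  show "\<forall>\<^sub>F x in at_top. 0 \<le> f' x"
    using eventually_gt_at_top[of 0]
    by eventually_elim (use completely_monotonic_on_nonneg[OF f'] in simp)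
  show "\<forall>\<^sub>F x in at_top. f' x \<le> f (x - 1) - f x"
    using eventually_gt_at_top[of 1]
  proof eventually_elim
    case (elim x)
    obtain z where z: "x - 1 < z" "z < x" "f x - f (x - 1) = (x - (x - 1)) * - f' z"
      using MVT2[of "x - 1" x f "\<lambda>z. - f' z"] deriv elim by auto
    then show ?case
      using completely_monotonic_on_antimono[OF f', of z x] elim by simp
  qed
  have "filterlim (\<lambda>x. x - 1 :: real) at_top at_top"
    using filterlim_tendsto_add_at_top[OF tendsto_const[of "-1"] filterlim_ident] by simp
  then have "((\<lambda>x. f (x - 1)) \<longlongrightarrow> 0) at_top"
    by (rule filterlim_compose[OF lim])
  from tendsto_diff[OF this lim] show "((\<lambda>x. f (x - 1) - f x) \<longlongrightarrow> 0) at_top"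
    by simp
qed

lemma nonneg_of_shift_decreasing_tendsto_0:
  fixes h :: "real \<Rightarrow> real"
  assumes step: "\<And>x. 0 < x \<Longrightarrow> h (x + 1) \<le> h x" and lim: "(h \<longlongrightarrow> 0) at_top" and "0 < x"
  shows "0 \<le> h x"
proof -
  have le: "h (x + real k) \<le> h x" for k
  proof (induction k)
    case (Suc k)
    have "h (x + real k + 1) \<le> h (x + real k)"
      using \<open>0 < x\<close> by (intro step) simp
    with Suc show ?case
      by (simp add: add_ac)
  qed simp
  have "filterlim (\<lambda>k. x + real k) at_top sequentially"
    by (rule filterlim_tendsto_add_at_top[OF tendsto_const filterlim_real_sequentially])
  then have "(\<lambda>k. h (x + real k)) \<longlonglongrightarrow> 0"
    by (rule filterlim_compose[OF lim])
  then show ?thesis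
    by (rule LIMSEQ_le_const2) (use le in auto)
qed

text \<open>
  Writing the function as a difference of two completely monotonic functions that vanish at
  infinity is what makes every derivative of it vanish there, too. The assumptions pass from
  \<open>f - g\<close> to \<open>-(f - g)'\<close>, so coinduction reduces the claim to nonnegativity, which follows from
  telescoping.
\<close>

lemma completely_monotonic_diff_of_shift:
  assumes "completely_monotonic_on {0<..} f" "completely_monotonic_on {0<..} g"
    and "(f \<longlongrightarrow> 0) at_top" "(g \<longlongrightarrow> 0) at_top"
    and "completely_monotonic_on {0<..} (\<lambda>x. (f x - g x) - (f (x + 1) - g (x + 1)))"
  shows "completely_monotonic_on {0<..} (\<lambda>x. f x - g x)"
proof (rule completely_monotonic_on_coinduct)
  let ?P = "\<lambda>h. \<exists>f g. completely_monotonic_on {0<..} f \<and> completely_monotonic_on {0<..} g \<and>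
      (f \<longlongrightarrow> 0) at_top \<and> (g \<longlongrightarrow> 0) at_top \<and>
      completely_monotonic_on {0<..} (\<lambda>x. h x - h (x + 1)) \<and> h = (\<lambda>x. f x - g x)"
  show "?P (\<lambda>x. f x - g x)"
    using assms by blast
  fix h assume "?P h"
  then obtain f g where f: "completely_monotonic_on {0<..} f" "(f \<longlongrightarrow> 0) at_top"
    and g: "completely_monotonic_on {0<..} g" "(g \<longlongrightarrow> 0) at_top"
    and diff: "completely_monotonic_on {0<..} (\<lambda>x. h x - h (x + 1))"
    and h: "h = (\<lambda>x. f x - g x)"
    by blast
  have at: "at x within {0<..} = at x" if "0 < x" for x :: real
    using that by (simp add: at_within_open[of _ "{0<..}"])
  obtain f' where f': "completely_monotonic_on {0<..} f'"
    "\<And>x. 0 < x \<Longrightarrow> (f has_real_derivative - f' x) (at x)"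
    using completely_monotonic_on_derivE[OF f(1)] by (metis at greaterThan_iff)
  obtain g' where g': "completely_monotonic_on {0<..} g'"
    "\<And>x. 0 < x \<Longrightarrow> (g has_real_derivative - g' x) (at x)"
    using completely_monotonic_on_derivE[OF g(1)] by (metis at greaterThan_iff)
  obtain d' where d': "completely_monotonic_on {0<..} d'"
    "\<And>x. 0 < x \<Longrightarrow> ((\<lambda>x. h x - h (x + 1)) has_real_derivative - d' x) (at x)"
    using completely_monotonic_on_derivE[OF diff] by (metis at greaterThan_iff)
  define h' where "h' = (\<lambda>x. f' x - g' x)"
  have deriv: "(h has_real_derivative - h' x) (at x)" if "0 < x" for x
    unfolding h h'_def using f'(2)[OF that] g'(2)[OF that] by (auto intro!: derivative_eq_intros)
  have "d' x = h' x - h' (x + 1)" if "0 < x" for x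
  proof -
    have "((\<lambda>x. h (x + 1)) has_real_derivative - h' (x + 1)) (at x)"
      using deriv[of "x + 1"] that by (simp add: DERIV_shift)
    from DERIV_diff[OF deriv[OF that] this] d'(2)[OF that] show ?thesis
      by (auto dest: DERIV_unique)
  qed
  with d'(1) have diff': "completely_monotonic_on {0<..} (\<lambda>x. h' x - h' (x + 1))"
    by (rule completely_monotonic_on_cong) simp
  have lims: "(f' \<longlongrightarrow> 0) at_top" "(g' \<longlongrightarrow> 0) at_top"
    using completely_monotonic_deriv_tendsto_0 f f' g g' by blast+
  have lim: "(h \<longlongrightarrow> 0) at_top"
    unfolding h using tendsto_diff[OF f(2) g(2)] by simp
  have "0 \<le> h x" if "0 < x" for x
    by (rule nonneg_of_shift_decreasing_tendsto_0[OF _ lim that])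
       (use completely_monotonic_on_nonneg[OF diff] in force)
  moreover have "?P h'"
    using f'(1) g'(1) lims diff' unfolding h'_def by blast
  ultimately show "\<exists>h'. ?P h' \<and>
      (\<forall>x\<in>{0<..}. 0 \<le> h x \<and> (h has_real_derivative - h' x) (at x within {0<..}))"
    using deriv by (intro exI[of _ h']) (simp add: at)
qed

section \<open>Polygamma functions\<close>

lemma completely_monotonic_Polygamma:
  assumes "0 < n"
  shows "completely_monotonic_on {0<..} (\<lambda>x::real. (-1) ^ Suc n * Polygamma n x)"
  unfolding completely_monotonic_on_def
proof (intro exI[of _ "\<lambda>k x. (-1) ^ Suc n * Polygamma (n + k) x"] conjI allI ballI)
  fix k and x :: real assume "x \<in> {0<..}"
  then have x: "0 < x" "x \<notin> \<int>\<^sub>\<le>\<^sub>0"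
    by (auto elim!: nonpos_Ints_cases)
  show "((\<lambda>x. (-1) ^ Suc n * Polygamma (n + k) x) has_real_derivative
      (-1) ^ Suc n * Polygamma (n + Suc k) x) (at x within {0<..})"
    using x(2) by (auto intro!: derivative_eq_intros)
  have "0 \<le> (-1) ^ Suc (n + k) * Polygamma (n + k) x"
    using Polygamma_real_odd_pos[OF x(2), of "n + k"] Polygamma_real_even_neg[OF x(1), of "n + k"] assms
    by (cases "even (n + k)") auto
  then show "0 \<le> (-1) ^ k * ((-1) ^ Suc n * Polygamma (n + k) x)"
    by (simp add: power_add mult_ac)
qed simp

text \<open>
  Along the positive integers the values are, up to a constant, tails of the convergent series
  that defines the function at 1. Monotonicity extends the limit to real arguments.
\<close>

lemma Polygamma_tendsto_0:
  assumes "0 < n"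
  shows "((\<lambda>x::real. Polygamma n x) \<longlongrightarrow> 0) at_top"
proof -
  let ?f = "\<lambda>x::real. (-1) ^ Suc n * Polygamma n x"
  note cm = completely_monotonic_Polygamma[OF assms]
  have "(\<lambda>k. Polygamma n (1 + real k)) \<longlonglongrightarrow>
      Polygamma n 1 + (-1) ^ n * fact n * ((-1) ^ Suc n * Polygamma n 1 / fact n)"
  proof -
    have eq: "Polygamma n (1 + real k) =
        Polygamma n 1 + (-1) ^ n * fact n * (\<Sum>j<k. inverse ((1 + real j) ^ Suc n))" for k
      by (subst Polygamma_plus_of_nat) (auto simp: inverse_eq_divide add_eq_0_iff2)
    have "(\<lambda>k. inverse ((1 + real k) ^ Suc n)) sums ((-1) ^ Suc n * Polygamma n 1 / fact n)"
      using assms by (intro Polygamma_LIMSEQ) auto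
    then show ?thesis
      unfolding eq sums_def by (intro tendsto_intros)
  qed
  then have "(\<lambda>k. Polygamma n (1 + real k)) \<longlonglongrightarrow> 0"
    by (simp flip: power_mult_distrib)
  then have seq: "(\<lambda>k. ?f (1 + real k)) \<longlonglongrightarrow> 0"
    by (rule tendsto_mult_right_zero)
  have "(?f \<longlongrightarrow> 0) at_top"
  proof (rule order_tendstoI)
    fix a :: real assume "a < 0"
    show "\<forall>\<^sub>F x in at_top. a < ?f x"
      using eventually_gt_at_top[of 0]
      by eventually_elim (use \<open>a < 0\<close> completely_monotonic_on_nonneg[OF cm] in force)
  next
    fix a :: real assume "0 < a"
    then obtain k where k: "?f (1 + real k) < a"
      using order_tendstoD(2)[OF seq] by (auto simp: eventually_sequentially)
    show "\<forall>\<^sub>F x in at_top. ?f x < a"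
      using eventually_ge_at_top[of "1 + real k"]
      by eventually_elim (use k completely_monotonic_on_antimono[OF cm, of "1 + real k"] in force)
  qed
  from tendsto_mult_right_zero[OF this, of "(-1) ^ Suc n"] show ?thesis
    by (simp flip: mult.assoc power_mult_distrib)
qed

lemma tendsto_inverse_power_at_top:
  "0 < k \<Longrightarrow> ((\<lambda>x::real. 1 / x ^ k) \<longlongrightarrow> 0) at_top"
  by (intro tendsto_divide_0[OF tendsto_const] filterlim_at_top_imp_at_infinity
      filterlim_pow_at_top filterlim_ident)

text \<open>
  The terms are regrouped by sign into two completely monotonic functions. Since
  \<open>\<psi>'(y) - \<psi>'(y+1) = 1/y\<^sup>2\<close>, the telescoping difference is the rational function
  \<open>(5y\<^sup>2 + 5y + 1) / (30 y\<^sup>5 (y+1)\<^sup>5)\<close>.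
\<close>

lemma completely_monotonic_trigamma_bound:
  "completely_monotonic_on {0<..}
     (\<lambda>y::real. Polygamma 1 y - (1 / y + 1 / (2 * y^2) + 1 / (6 * y^3) - 1 / (30 * y^5)))"
proof -
  let ?f = "\<lambda>y::real. Polygamma 1 y + (1 / 30) * (1 / y ^ 5)"
  let ?g = "\<lambda>y::real. 1 / y ^ 1 + (1 / 2) * (1 / y ^ 2) + (1 / 6) * (1 / y ^ 3)"
  have "completely_monotonic_on {0<..} (\<lambda>y. ?f y - ?g y)"
  proof (rule completely_monotonic_diff_of_shift)
    show "completely_monotonic_on {0<..} ?f"
      using completely_monotonic_Polygamma[of 1] by (intro completely_monotonic_on_intros) auto
    show "completely_monotonic_on {0<..} ?g"
      by (intro completely_monotonic_on_intros) auto
    show "(?f \<longlongrightarrow> 0) at_top" "(?g \<longlongrightarrow> 0) at_top"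
      by (intro tendsto_add_zero tendsto_mult_right_zero Polygamma_tendsto_0
          tendsto_inverse_power_at_top; simp)+
    have "completely_monotonic_on {0<..} (\<lambda>y::real. (1 / 6) * (1 / y ^ 3 * (1 / (y + 1) ^ 5))
        + (1 / 6) * (1 / y ^ 4 * (1 / (y + 1) ^ 5)) + (1 / 30) * (1 / y ^ 5 * (1 / (y + 1) ^ 5)))"
      by (intro completely_monotonic_on_intros) auto
    then show "completely_monotonic_on {0<..} (\<lambda>y. (?f y - ?g y) - (?f (y + 1) - ?g (y + 1)))"
    proof (rule completely_monotonic_on_cong)
      fix y :: real assume "y \<in> {0<..}"
      then have y: "0 < y" "y + 1 \<noteq> 0"
        by auto
      have "Polygamma 1 (y + 1) = Polygamma 1 y - 1 / y ^ 2"
        using y(1) by (simp add: Polygamma_plus1 power2_eq_square)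
      then have "(?f y - ?g y) - (?f (y + 1) - ?g (y + 1))
          = 1 / y ^ 2 + (1 / 30) * (1 / y ^ 5) - (1 / 30) * (1 / (y + 1) ^ 5) - ?g y + ?g (y + 1)"
        by algebra
      also have "\<dots> = (1 / 6) * (1 / y ^ 3 * (1 / (y + 1) ^ 5))
            + (1 / 6) * (1 / y ^ 4 * (1 / (y + 1) ^ 5)) + (1 / 30) * (1 / y ^ 5 * (1 / (y + 1) ^ 5))"
        using y by (simp add: divide_simps) algebra
      finally show "(1 / 6) * (1 / y ^ 3 * (1 / (y + 1) ^ 5))
            + (1 / 6) * (1 / y ^ 4 * (1 / (y + 1) ^ 5)) + (1 / 30) * (1 / y ^ 5 * (1 / (y + 1) ^ 5))
          = (?f y - ?g y) - (?f (y + 1) - ?g (y + 1))"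
        by (rule sym)
    qed
  qed
  then show ?thesis
    by (rule completely_monotonic_on_cong) simp
qed

text \<open>
  Since \<open>\<psi>''(x+1) - \<psi>''(x) = 2/x\<^sup>3\<close>, the telescoping difference is
  \<open>(2x + 1) / (2 x\<^sup>4 (x+1)\<^sup>4)\<close>.
\<close>

lemma completely_monotonic_tetragamma_bound:
  "completely_monotonic_on {0<..}
     (\<lambda>x::real. Polygamma 2 x + 1 / x^2 + 1 / x^3 + 1 / (2 * x^4))"
proof -
  let ?f = "\<lambda>x::real. 1 / x ^ 2 + 1 / x ^ 3 + (1 / 2) * (1 / x ^ 4)"
  let ?g = "\<lambda>x::real. - Polygamma 2 x"
  have "completely_monotonic_on {0<..} (\<lambda>x. ?f x - ?g x)"
  proof (rule completely_monotonic_diff_of_shift)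
    show "completely_monotonic_on {0<..} ?f"
      by (intro completely_monotonic_on_intros) auto
    show "completely_monotonic_on {0<..} ?g"
      using completely_monotonic_Polygamma[of 2] by simp
    show "(?f \<longlongrightarrow> 0) at_top"
      by (intro tendsto_add_zero tendsto_mult_right_zero tendsto_inverse_power_at_top; simp)
    show "(?g \<longlongrightarrow> 0) at_top"
      using tendsto_minus[OF Polygamma_tendsto_0[of 2]] by simp
    have "completely_monotonic_on {0<..} (\<lambda>x::real. 1 / x ^ 3 * (1 / (x + 1) ^ 4)
        + (1 / 2) * (1 / x ^ 4 * (1 / (x + 1) ^ 4)))"
      by (intro completely_monotonic_on_intros) auto
    then show "completely_monotonic_on {0<..} (\<lambda>x. (?f x - ?g x) - (?f (x + 1) - ?g (x + 1)))"
    proof (rule completely_monotonic_on_cong)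
      fix x :: real assume "x \<in> {0<..}"
      then have x: "0 < x" "x + 1 \<noteq> 0"
        by auto
      have "Polygamma 2 (x + 1) = Polygamma 2 x + 2 / x ^ 3"
        using x(1) by (simp add: Polygamma_plus1 eval_nat_numeral)
      then have "(?f x - ?g x) - (?f (x + 1) - ?g (x + 1)) = ?f x - ?f (x + 1) - 2 / x ^ 3"
        by algebra
      also have "\<dots> = 1 / x ^ 3 * (1 / (x + 1) ^ 4) + (1 / 2) * (1 / x ^ 4 * (1 / (x + 1) ^ 4))"
        using x by (simp add: divide_simps) algebra
      finally show "1 / x ^ 3 * (1 / (x + 1) ^ 4) + (1 / 2) * (1 / x ^ 4 * (1 / (x + 1) ^ 4))
          = (?f x - ?g x) - (?f (x + 1) - ?g (x + 1))"
        by (rule sym)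
    qed
  qed
  then show ?thesis
    by (rule completely_monotonic_on_cong) simp
qed

section \<open>The square of trigamma plus tetragamma\<close>

theorem theorem1:
  fixes p g :: "real \<Rightarrow> real"
  defines "p \<equiv> \<lambda>x. 75 * x^10 + 900 * x^9 + 4840 * x^8 + 15370 * x^7 + 31865 * x^6
                    + 45050 * x^5 + 44101 * x^4 + 29700 * x^3 + 13290 * x^2 + 3600 * x + 450"
  defines "g \<equiv> \<lambda>x. (deriv Digamma x)^2 + deriv (deriv Digamma) x
                    - p x / (900 * x^4 * (x + 1)^10)"
  shows "completely_monotonic_on {0<..} g"
proof -
  define B where "B y = 1 / y + 1 / (2 * y^2) + 1 / (6 * y^3) - 1 / (30 * y^5)" for y :: real
  define R where "R x = 1 / x^2 + B (x + 1)" for x :: real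
  have lower: "completely_monotonic_on {0<..} (\<lambda>x. Polygamma 1 x - R x)"
  proof (rule completely_monotonic_on_cong)
    show "completely_monotonic_on {0<..} (\<lambda>x. Polygamma 1 (x + 1) - B (x + 1))"
      using completely_monotonic_on_shift[OF completely_monotonic_trigamma_bound, of 1]
      by (simp add: B_def)
    show "Polygamma 1 (x + 1) - B (x + 1) = Polygamma 1 x - R x" if "x \<in> {0<..}" for x
      using that by (simp add: R_def Polygamma_plus1 power2_eq_square)
  qed
  \<comment> \<open>The term \<open>-1/(30 (x+1)\<^sup>5)\<close> of \<open>R\<close> is absorbed by expanding \<open>1/x\<^sup>2\<close> in powers of
      \<open>u = 1/(x+1)\<close>: it equals \<open>u\<^sup>2/(1 - u)\<^sup>2 = u\<^sup>2 + 2u\<^sup>3 + 3u\<^sup>4 + 4u\<^sup>5\<close> plus the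
      remainder \<open>5u\<^sup>5/x + u\<^sup>5/x\<^sup>2\<close>.\<close>
  have "completely_monotonic_on {0<..} (\<lambda>x::real. 1 / (x + 1) ^ 1 + (3 / 2) * (1 / (x + 1) ^ 2)
      + (13 / 6) * (1 / (x + 1) ^ 3) + 3 * (1 / (x + 1) ^ 4) + (119 / 30) * (1 / (x + 1) ^ 5)
      + 5 * (1 / x ^ 1 * (1 / (x + 1) ^ 5)) + 1 / x ^ 2 * (1 / (x + 1) ^ 5))"
    by (intro completely_monotonic_on_intros) auto
  then have R: "completely_monotonic_on {0<..} R"
  proof (rule completely_monotonic_on_cong)
    fix x :: real assume "x \<in> {0<..}"
    then have x: "x \<noteq> 0" "x + 1 \<noteq> 0"
      by auto
    then show "1 / (x + 1) ^ 1 + (3 / 2) * (1 / (x + 1) ^ 2)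
        + (13 / 6) * (1 / (x + 1) ^ 3) + 3 * (1 / (x + 1) ^ 4) + (119 / 30) * (1 / (x + 1) ^ 5)
        + 5 * (1 / x ^ 1 * (1 / (x + 1) ^ 5)) + 1 / x ^ 2 * (1 / (x + 1) ^ 5) = R x"
      unfolding R_def B_def by (simp add: divide_simps) algebra
  qed
  have "completely_monotonic_on {0<..} (\<lambda>x. (Polygamma 1 x - R x) * (Polygamma 1 x + R x)
      + (Polygamma 2 x + 1 / x^2 + 1 / x^3 + 1 / (2 * x^4)))"
    using completely_monotonic_Polygamma[of 1]
    by (intro completely_monotonic_on_add[OF completely_monotonic_on_mult[OF lower
        completely_monotonic_on_add[OF _ R]] completely_monotonic_tetragamma_bound]) simp
  then show ?thesis
  proof (rule completely_monotonic_on_cong)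
    fix x :: real assume "x \<in> {0<..}"
    then have x: "0 < x" "x \<noteq> 0" "x + 1 \<noteq> 0"
      by auto
    have "p x / (900 * x^4 * (x + 1)^10) = (R x)^2 - (1 / x^2 + 1 / x^3 + 1 / (2 * x^4))"
      unfolding p_def R_def B_def using x(2,3) by (simp add: divide_simps) algebra
    moreover have "deriv Digamma x = Polygamma 1 x" "deriv (deriv Digamma) x = Polygamma 2 x"
      using x(1) by (simp_all add: deriv_Polygamma_real deriv_deriv_Digamma_real)
    ultimately show "(Polygamma 1 x - R x) * (Polygamma 1 x + R x)
        + (Polygamma 2 x + 1 / x^2 + 1 / x^3 + 1 / (2 * x^4)) = g x"
      unfolding g_def by (simp add: algebra_simps power2_eq_square)
  qed
qed

end
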